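(* Let $V\ge 1$ be an integer, let $z^t, z^s\in\mathbb{R}^V$ be (teacher and student logit) vectors, and let $\tau\ge 1$. Let $p^\tau=\mathrm{softmax}(z^t/\tau)$, $q^\tau=\mathrm{softmax}(z^s/\tau)$, $\mathcal{L}_{\mathrm{RKL}}=D_{\mathrm{KL}}(q^\tau\Vert p^\tau)$, and $\Delta_i=z_i^s-z_i^t$ for $i\in\{1,\dots,V\}$. Then, for every $i\in\{1,\dots,V\}$, $$\nabla_{z_i^s}\mathcal{L}_{\mathrm{RKL}}=\frac{q_i^\tau}{\tau^2}\left(\Delta_i-\mathbb{E}_{j\sim q^\tau}[\Delta_j]\right).$$
   Context: For $z\in\mathbb{R}^V$, $\mathrm{softmax}(z)$ is the probability vector with entries $\exp(z_i)/\sum_{j=1}^V\exp(z_j)$. For probability vectors $a,b$ with positive entries, $D_{\mathrm{KL}}(a\Vert b)=\sum_{i=1}^V a_i\log(a_i/b_i)$ (natural logarithm). $\nabla_{z_i^s}$ denotes the partial derivative with respect to the $i$-th coordinate $z_i^s$ of $z^s$, where $\mathcal{L}_{\mathrm{RKL}}$ is regarded as a function of $z^s\in\mathbb{R}^V$ with $z^t$ and $\tau$ held fixed. $\mathbb{E}_{j\sim q^\tau}[\Delta_j]=\sum_{j=1}^V q_j^\tau\Delta_j$. *)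

theory Defs
  imports "HOL-Analysis.Analysis"
begin

definition softmax :: "real ^ 'n \<Rightarrow> real ^ 'n" where
  "softmax z = (\<chi> i. exp (z $ i) / (\<Sum>j\<in>UNIV. exp (z $ j)))"

(* Meaningful for probability vectors with positive entries, such as values of softmax. *)
definition KL_div :: "real ^ 'n \<Rightarrow> real ^ 'n \<Rightarrow> real" where
  "KL_div a b = (\<Sum>i\<in>UNIV. a $ i * ln (a $ i / b $ i))"

(* The i-th partial derivative of f at z exists and equals D: the i-th coordinate u varies
   near z $ i and all other coordinates of z stay fixed. *)
definition has_partial_derivative ::
    "(real ^ 'n \<Rightarrow> real) \<Rightarrow> 'n \<Rightarrow> real \<Rightarrow> real ^ 'n \<Rightarrow> bool" where
  "has_partial_derivative f i D z \<longleftrightarrow>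
     ((\<lambda>u. f (\<chi> j. if j = i then u else z $ j)) has_real_derivative D) (at (z $ i))"

definition reverse_KL_loss :: "real \<Rightarrow> real ^ 'n \<Rightarrow> real ^ 'n \<Rightarrow> real" where
  "reverse_KL_loss \<tau> zt zs = KL_div (softmax (zs /\<^sub>R \<tau>)) (softmax (zt /\<^sub>R \<tau>))"

end

theory Submission
  imports Defs
begin

text \<open>With \<open>e\<^sub>j = exp (z\<^sub>j / \<tau>)\<close> and \<open>S = \<Sum>j. e\<^sub>j\<close>, the loss equals
  \<open>(\<Sum>j. e\<^sub>j \<Delta>\<^sub>j) / (\<tau> S) - ln S + const\<close>. In the derivative with respect to \<open>z\<^sub>i\<close>,
  the term \<open>e\<^sub>i / (\<tau> S)\<close> from differentiating the factor \<open>\<Delta>\<^sub>i\<close> cancels against the derivative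
  of \<open>ln S\<close>.\<close>

lemma softmax_scale_nth:
  fixes z :: "real ^ 'n"
  shows "softmax (z /\<^sub>R \<tau>) $ i = exp (z $ i / \<tau>) / (\<Sum>j\<in>UNIV. exp (z $ j / \<tau>))"
  by (simp add: softmax_def divide_inverse mult.commute)

lemma sum_exp_pos:
  fixes z :: "'n::finite \<Rightarrow> real"
  shows "(\<Sum>j\<in>UNIV. exp (z j)) > 0"
  by (simp add: sum_pos)

text \<open>Logarithms of softmax entries are scaled logits minus the log of the normalizer, so each
  log-ratio is affine in the logit gap. This leaves \<open>zs\<close> only in two coordinatewise
  sums, ready for differentiation.\<close>

lemma reverse_KL_loss_eq:
  fixes zt zs :: "real ^ 'n" and \<tau> :: real
  defines "S \<equiv> \<Sum>j\<in>UNIV. exp (zs $ j / \<tau>)"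
  shows "reverse_KL_loss \<tau> zt zs =
    (\<Sum>j\<in>UNIV. exp (zs $ j / \<tau>) * (zs $ j - zt $ j)) / (\<tau> * S)
      - ln S + ln (\<Sum>j\<in>UNIV. exp (zt $ j / \<tau>))"
proof -
  define T where "T = (\<Sum>j\<in>UNIV. exp (zt $ j / \<tau>))"
  define e where "e j = exp (zs $ j / \<tau>)" for j
  have S: "S > 0" and T: "T > 0"
    unfolding S_def T_def by (rule sum_exp_pos)+
  have "ln ((e j / S) / (exp (zt $ j / \<tau>) / T)) = (zs $ j - zt $ j) / \<tau> - ln S + ln T" for j
    using S T by (simp add: e_def ln_div ln_mult diff_divide_distrib)
  then have "reverse_KL_loss \<tau> zt zs = (\<Sum>j\<in>UNIV. e j / S * ((zs $ j - zt $ j) / \<tau> - ln S + ln T))"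
    unfolding reverse_KL_loss_def KL_div_def softmax_scale_nth
    by (simp add: e_def S_def T_def)
  also have "\<dots> = (\<Sum>j\<in>UNIV. e j * (zs $ j - zt $ j) / (\<tau> * S) + e j * ((ln T - ln S) / S))"
    by (rule sum.cong) (auto simp: field_simps add_divide_distrib diff_divide_distrib)
  \<comment> \<open>The weights \<open>e j\<close> sum to \<open>S\<close>, so the part of the
    log-ratio that does not depend on \<open>j\<close> comes out with total weight 1.\<close>
  also have "\<dots> = (\<Sum>j\<in>UNIV. e j * (zs $ j - zt $ j)) / (\<tau> * S) + S * ((ln T - ln S) / S)"
    by (simp add: sum.distrib sum_divide_distrib sum_distrib_right e_def S_def)
  finally show ?thesis
    using S by (simp add: e_def T_def)
qed

text \<open>Only the summand at \<open>i\<close> varies with \<open>u\<close>; the others form a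
  constant. The summand may depend on its index because the numerator of the loss involves
  \<open>zt $ j\<close>.\<close>

lemma has_real_derivative_sum_coordinate:
  fixes f :: "'n::finite \<Rightarrow> real \<Rightarrow> real"
  assumes "(f i has_real_derivative D) (at x)"
  shows "((\<lambda>u. \<Sum>j\<in>UNIV. f j (if j = i then u else z j)) has_real_derivative D) (at x)"
proof -
  have "((\<lambda>u. f i u + (\<Sum>j\<in>UNIV - {i}. f j (z j))) has_real_derivative D) (at x)"
    using DERIV_add[OF assms DERIV_const] by simp
  moreover have "(\<Sum>j\<in>UNIV. f j (if j = i then u else z j)) = f i u + (\<Sum>j\<in>UNIV - {i}. f j (z j))" for u
    by (subst sum.remove[of _ i]) (auto intro!: sum.cong)
  ultimately show ?thesis by simp
qed

theorem proposition2p2: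
  fixes zt zs :: "real ^ 'n" and \<tau> :: real and i :: 'n
  assumes "\<tau> \<ge> 1"
  shows "let q = softmax (zs /\<^sub>R \<tau>); \<Delta> = (\<lambda>j. zs $ j - zt $ j)
         in has_partial_derivative (reverse_KL_loss \<tau> zt) i
              (q $ i / \<tau>\<^sup>2 * (\<Delta> i - (\<Sum>j\<in>UNIV. q $ j * \<Delta> j))) zs"
proof -
  define S where "S u = (\<Sum>j\<in>UNIV. exp ((if j = i then u else zs $ j) / \<tau>))" for u
  define N where "N u = (\<Sum>j\<in>UNIV. exp ((if j = i then u else zs $ j) / \<tau>)
    * ((if j = i then u else zs $ j) - zt $ j))" for u
  define e where "e = exp (zs $ i / \<tau>)"
  define d where "d = zs $ i - zt $ i"
  define x where "x = zs $ i"
  have \<tau>: "\<tau> \<noteq> 0" using assms by simp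
  have S_pos: "S u > 0" for u
    unfolding S_def by (rule sum_exp_pos)
  \<comment> \<open>At the base point the modified vector is \<open>zs\<close> itself, so
    \<open>S x\<close> and \<open>N x\<close> are the sums for the original logits.\<close>
  have unchanged: "(if j = i then x else zs $ j) = zs $ j" for j
    by (simp add: x_def)
  have S': "(S has_real_derivative e / \<tau>) (at x)"
    unfolding S_def e_def x_def using \<tau>
    by (intro has_real_derivative_sum_coordinate[where f = "\<lambda>_ v. exp (v / \<tau>)"])
      (auto intro!: derivative_eq_intros)
  have N': "(N has_real_derivative e * d / \<tau> + e) (at x)"
    unfolding N_def e_def d_def x_def using \<tau>
    by (intro has_real_derivative_sum_coordinate[where f = "\<lambda>j v. exp (v / \<tau>) * (v - zt $ j)"])
      (auto intro!: derivative_eq_intros)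
  \<comment> \<open>Differentiating the denominator \<open>\<tau> * S u\<close> produces the term
    with \<open>N x / S x\<close>, which is the mean of the logit gaps under the student
    distribution.\<close>
  have "((\<lambda>u. N u / (\<tau> * S u) - ln (S u) + ln (\<Sum>j\<in>UNIV. exp (zt $ j / \<tau>)))
      has_real_derivative e / S x / \<tau>\<^sup>2 * (d - N x / S x)) (at x)"
    using S_pos[of x] \<tau>
    by (auto intro!: derivative_eq_intros S' N' simp: field_simps power2_eq_square)
  moreover have "(\<Sum>j\<in>UNIV. softmax (zs /\<^sub>R \<tau>) $ j * (zs $ j - zt $ j)) = N x / S x"
    by (simp add: softmax_scale_nth N_def S_def unchanged sum_divide_distrib)
  moreover have "softmax (zs /\<^sub>R \<tau>) $ i = e / S x"
    by (simp add: softmax_scale_nth e_def S_def unchanged)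
  ultimately show ?thesis
    by (simp add: Let_def has_partial_derivative_def reverse_KL_loss_eq S_def N_def d_def x_def)
qed

end
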